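(* Let $A$ be a finite alphabet, and let $C\subseteq A^\ast$ be a finitely based downward closed set under the factor ordering. Then $C$ is well quasi-ordered if and only if the factor graph $\Gamma(C)$ has a path-complete decomposition into bicycles.
   Context: A word $u\in A^\ast$ is a factor of $v\in A^\ast$ ($u\le_f v$) if $v=yuz$ for some $y,z\in A^\ast$. $C\subseteq A^\ast$ is downward closed if $v\in C$, $u\le_f v$ imply $u\in C$. The basis of $C$ is the set of $\le_f$-minimal elements of $A^\ast\setminus C$; $C$ is finitely based if its basis is finite. Let $b$ be the maximum length of a basis element; the basis is understood to be nonempty and $b\ge1$. A poset is well quasi-ordered if it has no infinite strictly decreasing sequences and no infinite antichains; $C$ is ordered by $\le_f$. The factor graph $\Gamma(C)$ is the digraph whose vertices are the words of length $b$ in $C$, with an edge from $w$ to $w'$ precisely when $w=au$ and $w'=ua'$ for some $a,a'\in A$ and a word $u$ of length $b-1$ (loops are allowed). In a digraph $G$, a path is a sequence $v_1\to\dots\to v_k$ ($k\ge1$) with an edge from $v_i$ to $v_{i+1}$ for each $i$ (vertices may repeat); it is simple if its vertices are distinct; a simple cycle is a path with $k\ge2$, $v_1=v_k$ and $v_1,\dots,v_{k-1}$ distinct. $\operatorname{Path}(G)$ is the set of all paths in $G$. A finite collection of subgraphs $H_1,\dots,H_n$ of $G$ is a path-complete decomposition of $G$ if $\operatorname{Path}(G)=\bigcup_{i=1}^n\operatorname{Path}(H_i)$ (the empty collection being allowed if $G$ has no vertices); it is a decomposition into bicycles if each $H_i$ is a bicycle. A bicycle is a digraph consisting precisely of two vertex-disjoint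 simple cycles $\pi_1$ (initial cycle) and $\pi_2$ (terminal cycle), connected by a simple directed path $\tau$ (connecting path) from a vertex of $\pi_1$ to a vertex of $\pi_2$, no internal vertex of which belongs to $\pi_1$ or $\pi_2$. Either or both of $\pi_1,\pi_2$ are allowed to be absent (so a simple path, or a simple cycle with a simple path leading into it or out of it and otherwise disjoint from it, are bicycles), and a single simple cycle is also a bicycle; but if both cycles are present they share no vertex. *)

theory Defs
  imports
    "HOL-Library.Sublist"
    "Graph_Theory.Digraph_Component"
    "Graph_Theory.Pair_Digraph"
    "Graph_Theory.Vertex_Walk"
begin

text \<open>
  Words over \<open>A\<close> are the elements of \<^term>\<open>lists A\<close>; the factor order is \<^const>\<open>sublist\<close>
  (contiguous sublists).
\<close>

definition downward_closed :: "'a list set \<Rightarrow> bool" where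
  "downward_closed C \<longleftrightarrow> (\<forall>u v. v \<in> C \<and> sublist u v \<longrightarrow> u \<in> C)"

definition basis :: "'a set \<Rightarrow> 'a list set \<Rightarrow> 'a list set" where
  "basis A C = {w \<in> lists A - C. \<not> (\<exists>u \<in> lists A - C. strict_sublist u w)}"

definition finitely_based :: "'a set \<Rightarrow> 'a list set \<Rightarrow> bool" where
  "finitely_based A C \<longleftrightarrow> finite (basis A C)"

text \<open>Only meaningful if the basis is finite and nonempty.\<close>

definition basis_bound :: "'a set \<Rightarrow> 'a list set \<Rightarrow> nat" where
  "basis_bound A C = Max (length ` basis A C)"

definition wqo_on :: "('b \<Rightarrow> 'b \<Rightarrow> bool) \<Rightarrow> 'b set \<Rightarrow> bool" where
  "wqo_on le S \<longleftrightarrow>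
     \<not> (\<exists>f :: nat \<Rightarrow> 'b. (\<forall>i. f i \<in> S) \<and> (\<forall>i. le (f (Suc i)) (f i) \<and> f (Suc i) \<noteq> f i)) \<and>
     \<not> (\<exists>T \<subseteq> S. infinite T \<and> (\<forall>x\<in>T. \<forall>y\<in>T. x \<noteq> y \<longrightarrow> \<not> le x y))"

definition factor_graph :: "'a set \<Rightarrow> 'a list set \<Rightarrow> 'a list pair_pre_digraph" where
  "factor_graph A C =
     (let b = basis_bound A C; V = {w \<in> C. length w = b}
      in \<lparr> pverts = V,
           parcs = {(w, w'). w \<in> V \<and> w' \<in> V \<and>
             (\<exists>a \<in> A. \<exists>a' \<in> A. \<exists>u. length u = b - 1 \<and> w = a # u \<and> w' = u @ [a'])} \<rparr>)"

text \<open>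
  A path \<open>v\<^sub>1 \<rightarrow> \<dots> \<rightarrow> v\<^sub>k\<close> (\<open>k \<ge> 1\<close>, repetitions allowed) is a \<^const>\<open>vwalk\<close>,
  and a simple path is a \<^const>\<open>vpath\<close>.
\<close>

definition Paths :: "'v pair_pre_digraph \<Rightarrow> 'v list set" where
  "Paths G = {p. vwalk p G}"

definition simple_cycle :: "'v list \<Rightarrow> 'v pair_pre_digraph \<Rightarrow> bool" where
  "simple_cycle p G \<longleftrightarrow> vwalk p G \<and> 2 \<le> length p \<and> hd p = last p \<and> distinct (butlast p)"

text \<open>
  The empty list encodes an absent cycle. The connecting path \<open>\<tau>\<close> meets each cycle that is present
  in exactly one vertex, namely its endpoint. It may consist of a single vertex, so a lone cycle
  is the case of one absent cycle and a one-vertex \<open>\<tau>\<close>. If both cycles are present, disjointness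
  forces \<open>\<tau>\<close> to have at least one edge.
\<close>

definition bicycle :: "'v pair_pre_digraph \<Rightarrow> bool" where
  "bicycle H \<longleftrightarrow> (\<exists>\<pi>\<^sub>1 \<tau> \<pi>\<^sub>2.
     (\<pi>\<^sub>1 = [] \<or> simple_cycle \<pi>\<^sub>1 H \<and> set \<tau> \<inter> set \<pi>\<^sub>1 = {hd \<tau>}) \<and>
     (\<pi>\<^sub>2 = [] \<or> simple_cycle \<pi>\<^sub>2 H \<and> set \<tau> \<inter> set \<pi>\<^sub>2 = {last \<tau>}) \<and>
     vpath \<tau> H \<and>
     set \<pi>\<^sub>1 \<inter> set \<pi>\<^sub>2 = {} \<and>
     pverts H = set \<pi>\<^sub>1 \<union> set \<tau> \<union> set \<pi>\<^sub>2 \<and>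
     parcs H = set (vwalk_arcs \<pi>\<^sub>1) \<union> set (vwalk_arcs \<tau>) \<union> set (vwalk_arcs \<pi>\<^sub>2))"

definition path_complete_decomposition ::
  "'v pair_pre_digraph \<Rightarrow> 'v pair_pre_digraph set \<Rightarrow> bool" where
  "path_complete_decomposition G \<H> \<longleftrightarrow>
     finite \<H> \<and> (\<forall>H \<in> \<H>. subgraph H G) \<and> Paths G = (\<Union>H \<in> \<H>. Paths H)"

end

theory Submission
  imports Defs
begin

text \<open>
  Since \<open>b\<close> bounds the minimal forbidden factors, a word of length at least \<open>b\<close> lies in \<open>C\<close>
  exactly if its factors of length \<open>b\<close> do. So reading off these factors turns the long words of
  \<open>C\<close> into the paths of the factor graph, and it preserves and reflects the factor ordering
  (\<open>wqo_iff_wqo_Paths\<close>). The short words are finite in number. What remains is a fact about finite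
  digraphs: the paths of \<open>G\<close> are well quasi-ordered by contiguous containment if and only if \<open>G\<close>
  has a path-complete decomposition into bicycles. The link between the two conditions is the
  \<^emph>\<open>in-out cycle\<close>, a simple cycle that has both an arc \<open>(x, v)\<close> entering it and an arc \<open>(v', y)\<close>
  leaving it, neither being an arc of the cycle.

  If there is an in-out cycle, the paths that enter it by \<open>(x, v)\<close>, run around it for some time
  and leave it by \<open>(v', y)\<close> form an infinite antichain: the entering and the leaving arc occur only
  at the two ends of such a path, so none of these paths fits inside another
  (\<open>infinite_antichain_in_out_cycle\<close>).

  If there is none, every path lies in a bicycle (\<open>path_in_bicycle\<close>). Consider the first repeated
  vertex of the path. If the path has entered the cycle closed there from outside, it can never
  leave that cycle again. If the path started on that cycle and leaves it, the cycle cannot be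
  entered again, and the same argument applies to the rest of the path. A finite digraph has only
  finitely many subgraphs, so its bicycles form a path-complete decomposition.

  Conversely, a path of a bicycle is a piece running along the initial cycle, a piece of the
  connecting path, and a piece running along the terminal cycle. There are finitely many choices
  for the middle piece and for the vertices at which the outer pieces are joined to it; once these
  are chosen, the path is determined by the lengths of its outer pieces, and longer pieces extend
  shorter ones outwards. So the paths of a bicycle have no infinite antichain, because pairs of
  natural numbers have none (\<open>finite_antichain_bicycle\<close>).
\<close>

section \<open>Antichains of words\<close>

definition sublist_antichain :: "'b list set \<Rightarrow> bool" where
  "sublist_antichain T \<longleftrightarrow> (\<forall>x\<in>T. \<forall>y\<in>T. x \<noteq> y \<longrightarrow> \<not> sublist x y)"

lemma sublist_length_less: "sublist u w \<Longrightarrow> u \<noteq> w \<Longrightarrow> length u < length w"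
  by (auto simp: sublist_def)

text \<open>A strict factor is shorter, so only antichains can obstruct well quasi-ordering.\<close>

lemma wqo_on_sublist_iff:
  "wqo_on sublist S \<longleftrightarrow> (\<forall>T\<subseteq>S. sublist_antichain T \<longrightarrow> finite T)"
proof -
  have "\<not> (\<exists>f :: nat \<Rightarrow> 'a list. (\<forall>i. f i \<in> S) \<and> (\<forall>i. sublist (f (Suc i)) (f i) \<and> f (Suc i) \<noteq> f i))"
  proof
    assume "\<exists>f :: nat \<Rightarrow> 'a list. (\<forall>i. f i \<in> S) \<and> (\<forall>i. sublist (f (Suc i)) (f i) \<and> f (Suc i) \<noteq> f i)"
    then obtain f :: "nat \<Rightarrow> 'a list"
      where f: "\<And>i. sublist (f (Suc i)) (f i) \<and> f (Suc i) \<noteq> f i" by blast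
    have "length (f (Suc i)) < length (f i)" for i
    proof -
      show ?thesis using f[of i] by (metis sublist_length_less)
    qed
    then have "(f (Suc i), f i) \<in> measure length" for i by simp
    then show False using wf_measure[of length] unfolding wf_iff_no_infinite_down_chain by blast
  qed
  then show ?thesis unfolding wqo_on_def sublist_antichain_def by blast
qed

lemma sublist_antichain_subset: "sublist_antichain T \<Longrightarrow> S \<subseteq> T \<Longrightarrow> sublist_antichain S"
  unfolding sublist_antichain_def by blast

section \<open>Words as paths in the factor graph\<close>

text \<open>
  The factors of length \<open>b\<close> of a word, from left to right. This is the path that the word traces
  in the factor graph.
\<close>

fun windows :: "nat \<Rightarrow> 'a list \<Rightarrow> 'a list list" where
  "windows b [] = []"
| "windows b (a # w) = (if b \<le> length (a # w) then take b (a # w) # windows b w else [])"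

lemma windows_eq_Nil_iff: "1 \<le> b \<Longrightarrow> windows b w = [] \<longleftrightarrow> length w < b"
  by (cases w) auto

lemma suffix_windows: "1 \<le> b \<Longrightarrow> suffix u w \<Longrightarrow> suffix (windows b u) (windows b w)"
proof (induction w)
  case (Cons a w)
  show ?case
  proof (cases "u = a # w")
    case False
    then have "suffix u w" using Cons.prems(2) by (simp add: suffix_Cons)
    then have s: "suffix (windows b u) (windows b w)" and "length u \<le> length w"
      using Cons suffix_length_le by auto
    then show ?thesis
      using Cons.prems(1) windows_eq_Nil_iff[of b u] by (auto simp: suffix_Cons)
  qed simp
qed simp

lemma prefix_windows: "prefix u w \<Longrightarrow> prefix (windows b u) (windows b w)"
proof (induction u arbitrary: w)
  case (Cons a u)
  then obtain w' where w: "w = a # w'" "prefix u w'" by (cases w) auto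
  moreover have "take b (a # u) = take b (a # w')" if "b \<le> Suc (length u)"
    using that w(2) by (cases b) (auto simp: prefix_def)
  ultimately show ?case using Cons.IH[of w'] prefix_length_le[of u w'] by auto
qed simp

lemma sublist_windows: "1 \<le> b \<Longrightarrow> sublist u w \<Longrightarrow> sublist (windows b u) (windows b w)"
  by (metis prefix_windows suffix_windows sublist_altdef)

text \<open>
  Reading the first letters of the windows recovers the word, so an initial segment of the path
  forces an initial segment of the word. The bound \<open>b \<le> length u\<close> excludes words without windows.
\<close>

lemma prefix_if_prefix_windows:
  "1 \<le> b \<Longrightarrow> b \<le> length u \<Longrightarrow> prefix (windows b u) (windows b w) \<Longrightarrow> prefix u w"
proof (induction u arbitrary: w)
  case (Cons a u)
  obtain a' w' where w: "w = a' # w'" "b \<le> length w"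
    using Cons.prems by (cases w) (auto split: if_splits)
  have eq: "take b (a # u) = take b w" and pre: "prefix (windows b u) (windows b w')"
    using Cons.prems w by auto
  show ?case
  proof (cases "b \<le> length u")
    case True
    then have "prefix u w'" using Cons.IH Cons.prems(1) pre by blast
    moreover have "a = a'" using eq w Cons.prems(1) by (cases b) auto
    ultimately show ?thesis using w by simp
  next
    case False
    then have "a # u = take b w" using eq by simp
    then show ?thesis by (metis take_is_prefix)
  qed
qed simp

lemma sublist_if_sublist_windows:
  "1 \<le> b \<Longrightarrow> b \<le> length u \<Longrightarrow> sublist (windows b u) (windows b w) \<Longrightarrow> sublist u w"
proof (induction w)
  case Nil
  then show ?case using windows_eq_Nil_iff[of b u] by auto
next
  case (Cons a w)
  have "prefix (windows b u) (windows b (a # w)) \<or> sublist (windows b u) (windows b w)"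
  proof (cases "b \<le> length (a # w)")
    case True
    then show ?thesis using Cons.prems(3) by (auto simp: sublist_Cons_right)
  next
    case False
    then show ?thesis using Cons.prems windows_eq_Nil_iff[of b u] by auto
  qed
  then show ?case using Cons prefix_if_prefix_windows[of b u "a # w"]
    by (auto simp: sublist_Cons_right)
qed

lemma windows_inj:
  assumes "1 \<le> b" "b \<le> length u" "b \<le> length w" "windows b u = windows b w"
  shows "u = w"
  using assms sublist_if_sublist_windows[of b u w] sublist_if_sublist_windows[of b w u]
  by (simp add: sublist_order.order.antisym)

lemma set_windowsD: "v \<in> set (windows b w) \<Longrightarrow> sublist v w \<and> length v = b"
proof (induction w)
  case (Cons a w)
  have "sublist (take b (a # w)) (a # w)" by (rule sublist_take)
  with Cons show ?case by (auto split: if_splits simp: sublist_Cons_right)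
qed simp

lemma short_factor_in_window:
  "sublist z w \<Longrightarrow> length z \<le> b \<Longrightarrow> b \<le> length w \<Longrightarrow> 1 \<le> b \<Longrightarrow>
    \<exists>v \<in> set (windows b w). sublist z v"
proof (induction w)
  case (Cons a w)
  consider "prefix z (a # w)" | "b \<le> length w" "sublist z w" | "b = length (a # w)"
    using Cons.prems sublist_Cons_right[of z a w] by fastforce
  then show ?case
  proof cases
    case 1
    then have "prefix z (take b (a # w))"
      using Cons.prems by (metis prefix_length_prefix take_is_prefix length_take min.absorb2)
    then show ?thesis using Cons.prems by auto
  next
    case 2
    then show ?thesis using Cons by auto
  next
    case 3
    then show ?thesis using Cons.prems by auto
  qed
qed simp

lemma hd_windows: "1 \<le> b \<Longrightarrow> b \<le> length w \<Longrightarrow> hd (windows b w) = take b w"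
  by (cases w) auto

lemma exists_basis_factor:
  assumes "w \<in> lists A" "w \<notin> C"
  shows "\<exists>z \<in> basis A C. sublist z w"
  using assms
proof (induction "length w" arbitrary: w rule: less_induct)
  case less
  show ?case
  proof (cases "w \<in> basis A C")
    case False
    then obtain u where u: "u \<in> lists A - C" "sublist u w" "u \<noteq> w"
      using less.prems unfolding basis_def strict_sublist_def by auto
    then obtain z where "z \<in> basis A C" "sublist z u"
      using less.hyps[of u] sublist_length_less[of u w] by blast
    then show ?thesis using u(2) by (meson sublist_order.order.trans)
  qed auto
qed

text \<open>
  Membership in \<open>C\<close> can be tested on windows because \<open>b\<close> bounds the lengths of the minimal
  forbidden factors: each of them would show up in some window.
\<close>

lemma mem_if_windows_mem:
  assumes "downward_closed C" "C \<subseteq> lists A" "finitely_based A C" "1 \<le> basis_bound A C"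
    and len: "basis_bound A C \<le> length w"
    and sub: "set (windows (basis_bound A C) w) \<subseteq> C"
  shows "w \<in> C"
proof (rule ccontr)
  let ?b = "basis_bound A C"
  assume "w \<notin> C"
  have "x \<in> A" if x: "x \<in> set w" for x
  proof -
    have "sublist [x] w" using x by (metis split_list sublist_appendI append_Cons append_Nil)
    then obtain v where "v \<in> set (windows ?b w)" "sublist [x] v"
      using short_factor_in_window[of "[x]" w ?b] assms by auto
    then show ?thesis using sub assms(2) set_mono_sublist by fastforce
  qed
  then obtain z where z: "z \<in> basis A C" "sublist z w"
    using exists_basis_factor[of w A C] \<open>w \<notin> C\<close> by auto
  have "length z \<le> ?b"
    using z(1) assms(3) unfolding basis_bound_def finitely_based_def by simp
  then obtain v where "v \<in> set (windows ?b w)" "sublist z v"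
    using short_factor_in_window[of z w ?b] z assms by blast
  then have "z \<in> C" using sub assms(1) unfolding downward_closed_def by blast
  then show False using z(1) unfolding basis_def by blast
qed

lemma vwalk_pair_iff:
  "vwalk p (with_proj G) \<longleftrightarrow> p \<noteq> [] \<and> set p \<subseteq> pverts G \<and> set (vwalk_arcs p) \<subseteq> parcs G"
  unfolding vwalk_def by auto

lemma pverts_factor_graph: "pverts (factor_graph A C) = {w \<in> C. length w = basis_bound A C}"
  unfolding factor_graph_def by (simp add: Let_def)

lemma parcs_factor_graph_iff:
  "(w, w') \<in> parcs (factor_graph A C) \<longleftrightarrow>
     w \<in> pverts (factor_graph A C) \<and> w' \<in> pverts (factor_graph A C) \<and>
     (\<exists>a \<in> A. \<exists>a' \<in> A. \<exists>u. length u = basis_bound A C - 1 \<and> w = a # u \<and> w' = u @ [a'])"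
  unfolding factor_graph_def by (simp add: Let_def)

lemma windows_in_Paths:
  assumes "downward_closed C" "C \<subseteq> lists A" "1 \<le> basis_bound A C"
    and "w \<in> C" "basis_bound A C \<le> length w"
  shows "windows (basis_bound A C) w \<in> Paths (factor_graph A C)"
proof -
  let ?b = "basis_bound A C" and ?G = "factor_graph A C"
  have verts: "set (windows ?b w) \<subseteq> pverts ?G" if "w \<in> C" for w
    using that assms(1) set_windowsD[of _ ?b w]
    unfolding pverts_factor_graph downward_closed_def by blast
  have "set (vwalk_arcs (windows ?b w)) \<subseteq> parcs ?G" if "w \<in> C" for w
    using that
  proof (induction w)
    case (Cons a w)
    have "sublist w (a # w)" by (simp add: sublist_Cons_right)
    then have w: "w \<in> C" using Cons.prems assms(1) unfolding downward_closed_def by blast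
    show ?case
    proof (cases "?b \<le> length w")
      case True
      have ne: "windows ?b w \<noteq> []" using True assms(3) windows_eq_Nil_iff[of ?b w] by auto
      have "(take ?b (a # w), take ?b w) \<in> parcs ?G"
        unfolding parcs_factor_graph_iff
      proof (intro conjI bexI exI)
        show "take ?b (a # w) \<in> pverts ?G" using verts[OF Cons.prems] True by auto
        show "take ?b w \<in> pverts ?G"
          using verts[OF w] ne hd_windows[OF assms(3) True] by (metis hd_in_set subsetD)
        show "length (take (?b - 1) w) = ?b - 1" using True by simp
        show "take ?b (a # w) = a # take (?b - 1) w" using assms(3) by (cases ?b) auto
        show "take ?b w = take (?b - 1) w @ [w ! (?b - 1)]"
          using assms(3) True take_Suc_conv_app_nth[of "?b - 1" w] by simp
        show "a \<in> A" using Cons.prems assms(2) by auto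
        have "w ! (?b - 1) \<in> set w" using True assms(3) by (intro nth_mem) auto
        then show "w ! (?b - 1) \<in> A" using w assms(2) by auto
      qed
      then show ?thesis using Cons.IH[OF w] True ne hd_windows[OF assms(3) True] by auto
    next
      case False
      then have "windows ?b w = []" using assms(3) windows_eq_Nil_iff[of ?b w] by auto
      then show ?thesis by auto
    qed
  qed simp
  then show ?thesis
    using assms verts windows_eq_Nil_iff[of ?b w]
    unfolding Paths_def vwalk_pair_iff by auto
qed

text \<open>
  A path is spelled backwards from its end: each arc \<open>(a # x, x @ [a'])\<close> prepends the letter \<open>a\<close>.
\<close>

lemma Paths_spelled:
  assumes "downward_closed C" "C \<subseteq> lists A" "finitely_based A C" "1 \<le> basis_bound A C"
    and "p \<in> Paths (factor_graph A C)"
  shows "\<exists>w \<in> C. basis_bound A C \<le> length w \<and> windows (basis_bound A C) w = p"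
proof -
  let ?b = "basis_bound A C" and ?G = "factor_graph A C"
  have walk: "vwalk p ?G" using assms(5) unfolding Paths_def by simp
  then have "\<exists>w. ?b \<le> length w \<and> windows ?b w = p"
  proof (induction rule: vwalk_induct)
    case (Base u)
    then have "length u = ?b" by (simp add: pverts_factor_graph)
    then have "windows ?b u = [u]"
      using assms(4) windows_eq_Nil_iff[of ?b "tl u"] by (cases u) auto
    then show ?case using \<open>length u = ?b\<close> by (intro exI[of _ u]) simp
  next
    case (Cons u v es)
    then obtain w where w: "?b \<le> length w" "windows ?b w = v # es" by auto
    obtain a a' x where x: "length x = ?b - 1" "u = a # x" "v = x @ [a']"
      using Cons(1) by (auto simp: parcs_factor_graph_iff)
    have "take ?b w = x @ [a']" using hd_windows[OF assms(4) w(1)] w(2) x(3) by simp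
    then have "take (?b - 1) w = x"
      using x(1) by (metis append_eq_conv_conj diff_le_self min.absorb1 take_take)
    then have "take ?b (a # w) = u" using x(2) assms(4) by (cases ?b) auto
    then show ?case using w by (intro exI[of _ "a # w"]) auto
  qed
  then obtain w where w: "?b \<le> length w" "windows ?b w = p" by blast
  then have "w \<in> C"
    using mem_if_windows_mem[OF assms(1-4) w(1)] walk
    unfolding vwalk_pair_iff pverts_factor_graph by auto
  then show ?thesis using w by blast
qed

text \<open>
  Only finitely many words are shorter than \<open>b\<close>, and on the others \<^const>\<open>windows\<close> is an order
  isomorphism onto the paths.
\<close>

lemma wqo_iff_wqo_Paths:
  assumes "finite A" "C \<subseteq> lists A" "downward_closed C" "finitely_based A C"
    and "1 \<le> basis_bound A C"
  shows "wqo_on sublist C \<longleftrightarrow> wqo_on sublist (Paths (factor_graph A C))"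
proof -
  let ?b = "basis_bound A C" and ?P = "Paths (factor_graph A C)"
  let ?L = "{w \<in> C. ?b \<le> length w}"
  have inj: "inj_on (windows ?b) ?L"
    using windows_inj[OF assms(5)] by (intro inj_onI) blast
  have le_iff: "sublist (windows ?b u) (windows ?b w) \<longleftrightarrow> sublist u w" if "u \<in> ?L" for u w
    using that sublist_windows[OF assms(5), of u w]
      sublist_if_sublist_windows[OF assms(5), of u w] by blast
  have antichain_iff: "sublist_antichain (windows ?b ` T) \<longleftrightarrow> sublist_antichain T"
    if "T \<subseteq> ?L" for T
  proof -
    have "windows ?b u = windows ?b w \<longleftrightarrow> u = w" if "u \<in> T" "w \<in> T" for u w
      using that \<open>T \<subseteq> ?L\<close> inj_on_eq_iff[OF inj, of u w] by blast
    moreover have "sublist (windows ?b u) (windows ?b w) \<longleftrightarrow> sublist u w" if "u \<in> T" for u w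
      using that \<open>T \<subseteq> ?L\<close> le_iff[of u w] by blast
    ultimately show ?thesis unfolding sublist_antichain_def by simp
  qed
  have img: "windows ?b ` ?L = ?P"
    using windows_in_Paths[OF assms(3,2,5)] Paths_spelled[OF assms(3,2,4,5)] by blast
  have fin: "finite (C - ?L)"
  proof (rule finite_subset)
    show "C - ?L \<subseteq> {w. set w \<subseteq> A \<and> length w \<le> ?b}" using assms(2) by auto
    show "finite {w. set w \<subseteq> A \<and> length w \<le> ?b}" using assms(1) by (rule finite_lists_length_le)
  qed
  show ?thesis unfolding wqo_on_sublist_iff
  proof (intro iffI allI impI)
    fix S assume C: "\<forall>T\<subseteq>C. sublist_antichain T \<longrightarrow> finite T"
      and S: "S \<subseteq> ?P" "sublist_antichain S"
    obtain T where T: "T \<subseteq> ?L" "S = windows ?b ` T"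
      using S(1) unfolding img[symmetric] by (rule subset_imageE)
    then have "sublist_antichain T" using S(2) antichain_iff[OF T(1)] by simp
    moreover have "T \<subseteq> C" using T(1) by blast
    ultimately show "finite S" using T(2) C by blast
  next
    fix T assume P: "\<forall>S\<subseteq>?P. sublist_antichain S \<longrightarrow> finite S"
      and T: "T \<subseteq> C" "sublist_antichain T"
    have "sublist_antichain (windows ?b ` (T \<inter> ?L))"
      using antichain_iff[OF Int_lower2] sublist_antichain_subset[OF T(2) Int_lower1] by blast
    moreover have "windows ?b ` (T \<inter> ?L) \<subseteq> ?P"
      unfolding img[symmetric] by (rule image_mono[OF Int_lower2])
    ultimately have "finite (windows ?b ` (T \<inter> ?L))" using P by blast
    then have "finite (T \<inter> ?L)"
      using finite_image_iff[OF inj_on_subset[OF inj Int_lower2]] by blast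
    moreover have "T = (T \<inter> ?L) \<union> (T \<inter> (C - ?L))" using T(1) by blast
    ultimately show "finite T" using fin by (metis finite_Int finite_UnI)
  qed
qed

section \<open>Walks and cycles\<close>

lemma vwalk_arcs_subset_Sigma: "set (vwalk_arcs p) \<subseteq> set p \<times> set p"
  using arcs_in_vwalk_arcs by fast

lemma vwalk_arcs_append_iff:
  assumes "p \<noteq> []" "q \<noteq> []"
  shows "set (vwalk_arcs (p @ q)) \<subseteq> R \<longleftrightarrow>
    set (vwalk_arcs p) \<subseteq> R \<and> (last p, hd q) \<in> R \<and> set (vwalk_arcs q) \<subseteq> R"
  using assms by (auto simp: vwalk_arcs_append)

lemma vwalk_arcs_sublist: "sublist p q \<Longrightarrow> set (vwalk_arcs p) \<subseteq> set (vwalk_arcs q)"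
  unfolding sublist_def using set_vwalk_arcs_append1 set_vwalk_arcs_append2 by fast

lemma walk_stays_in_closed_set:
  assumes "set (vwalk_arcs p) \<subseteq> E" "p \<noteq> []" "hd p \<in> S"
    and "\<And>a b. (a, b) \<in> E \<Longrightarrow> a \<in> S \<Longrightarrow> b \<in> S"
  shows "set p \<subseteq> S"
  using assms(1-3)
proof (induction p)
  case (Cons x p)
  then show ?case using assms(4) by (cases "p = []") auto
qed simp

lemma distinct_no_arc_into_hd: "distinct p \<Longrightarrow> (x, hd p) \<notin> set (vwalk_arcs p)"
proof (cases p)
  case (Cons a q)
  then show "distinct p \<Longrightarrow> ?thesis"
    using arcs_in_vwalk_arcs[of "(x, a)" q] by (cases "q = []") auto
qed simp

lemma distinct_no_arc_from_last: "distinct p \<Longrightarrow> (last p, y) \<notin> set (vwalk_arcs p)"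
proof (induction p)
  case (Cons a p)
  then show ?case by (cases "p = []") auto
qed simp

lemma single_valued_distinct_butlast:
  "distinct (butlast p) \<Longrightarrow> single_valued (set (vwalk_arcs p))"
proof (induction p)
  case (Cons a p)
  show ?case
  proof (cases "p = []")
    case False
    have fresh: "(a, y) \<notin> set (vwalk_arcs p)" for y
    proof
      assume "(a, y) \<in> set (vwalk_arcs p)"
      then have "a \<in> set (butlast p)"
      proof (induction p)
        case (Cons b p)
        then show ?case by (cases "p = []") auto
      qed simp
      then show False using Cons.prems False by simp
    qed
    have "single_valued (set (vwalk_arcs p))" using Cons False by simp
    then show ?thesis using False fresh by (auto simp: single_valued_def)
  qed simp
qed simp

text \<open>
  This makes walks along a cycle deterministic in both directions: such a walk is given by its
  length and either one of its end vertices.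
\<close>

lemma single_valued_simple_cycle:
  assumes "simple_cycle c G"
  shows "single_valued (set (vwalk_arcs c))" "single_valued ((set (vwalk_arcs c))\<inverse>)"
proof -
  have len: "2 \<le> length c" and cyc: "hd c = last c" and dist: "distinct (butlast c)"
    using assms unfolding simple_cycle_def by auto
  show "single_valued (set (vwalk_arcs c))" using single_valued_distinct_butlast[OF dist] .
  obtain x d where c: "c = x # d @ [x]"
  proof -
    obtain x e where c: "c = x # e" using len by (cases c) auto
    then have "e \<noteq> []" using len by auto
    then have "e = butlast e @ [x]" using cyc c append_butlast_last_id[of e] by simp
    then show thesis using that[of x "butlast e"] c by simp
  qed
  then have "distinct (butlast (rev c))" using dist by auto
  from single_valued_distinct_butlast[OF this]
  show "single_valued ((set (vwalk_arcs c))\<inverse>)"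
    by (simp add: set_vwalk_arcs_rev converse_unfold)
qed

section \<open>Paths of a bicycle\<close>

text \<open>
  Comparing \<open>take 1\<close> instead of \<open>hd\<close> lets empty walks match only each other.
\<close>

lemma prefix_if_single_valued:
  assumes "single_valued r"
    and "set (vwalk_arcs p) \<subseteq> r" "set (vwalk_arcs q) \<subseteq> r"
    and "take 1 p = take 1 q" "length p \<le> length q"
  shows "prefix p q"
  using assms(2-)
proof (induction p arbitrary: q)
  case (Cons x p)
  then obtain q' where q: "q = x # q'" by (cases q) auto
  show ?case
  proof (cases "p = []")
    case False
    then have "q' \<noteq> []" using Cons.prems q by auto
    then have "hd p = hd q'"
      using Cons.prems False q assms(1) by (auto simp: single_valued_def)
    then have "take 1 p = take 1 q'" using False \<open>q' \<noteq> []\<close> by (simp add: take_Suc)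
    then show ?thesis using Cons False \<open>q' \<noteq> []\<close> q by auto
  qed (use q in simp)
qed simp

lemma suffix_if_single_valued:
  assumes "single_valued (r\<inverse>)"
    and "set (vwalk_arcs p) \<subseteq> r" "set (vwalk_arcs q) \<subseteq> r"
    and "take 1 (rev p) = take 1 (rev q)" "length p \<le> length q"
  shows "suffix p q"
  unfolding suffix_to_prefix
  using assms by (intro prefix_if_single_valued[of "r\<inverse>"]) (auto simp: set_vwalk_arcs_rev)

text \<open>
  A simple path carries no closed walk. This leaves only finitely many possibilities for the
  middle piece of a path in a bicycle.
\<close>

lemma distinct_if_arcs_of_distinct:
  "distinct t \<Longrightarrow> set (vwalk_arcs q) \<subseteq> set (vwalk_arcs t) \<Longrightarrow> distinct q"
proof (induction t arbitrary: q)
  case Nil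
  then show ?case by (cases q rule: vwalk_arcs.cases) auto
next
  case (Cons x t)
  show ?case
  proof (cases "t = []")
    case True
    then show ?thesis using Cons.prems by (cases q rule: vwalk_arcs.cases) auto
  next
    case False
    have into: "(a, x) \<notin> set (vwalk_arcs (x # t))" for a
      using distinct_no_arc_into_hd[OF Cons.prems(1)] by simp
    have no_x: "x \<notin> set (tl q)"
    proof
      assume "x \<in> set (tl q)"
      then obtain xs ys where "tl q = xs @ x # ys" by (meson split_list)
      then have q: "q = (hd q # xs) @ x # ys" by (cases q) auto
      have "(last (hd q # xs), x) \<in> set (vwalk_arcs q)"
        by (subst q, subst vwalk_arcs_append) auto
      then show False using Cons.prems(2) into by blast
    qed
    have "set (vwalk_arcs q') \<subseteq> set (vwalk_arcs t)"
      if "x \<notin> set q'" "set (vwalk_arcs q') \<subseteq> set (vwalk_arcs (x # t))" for q'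
      using that False arcs_in_vwalk_arcs[of _ q'] by auto
    moreover have "set (vwalk_arcs (tl q)) \<subseteq> set (vwalk_arcs (x # t))"
      using Cons.prems(2) vwalk_arcs_sublist[of "tl q" q] by auto
    ultimately have "distinct (tl q)" and "x \<notin> set q \<Longrightarrow> distinct q"
      using Cons.IH Cons.prems no_x by auto
    then show ?thesis using no_x by (cases q) auto
  qed
qed

text \<open>
  \<open>P1\<close> and \<open>P2\<close> stand for the vertex sets of the initial and the terminal cycle of a bicycle, and
  \<open>R1\<close>, \<open>R\<close>, \<open>R2\<close> for the arcs of the initial cycle, the connecting path and the terminal cycle.
  Once a walk has left \<open>P1\<close> it cannot return, and once it has reached \<open>P2\<close> it cannot get out; the
  cuts are made at these two moments.
\<close>

lemma bicycle_path_split: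
  fixes p :: "'v list"
  assumes "set (vwalk_arcs p) \<subseteq> E"
    and into: "\<And>x y. (x, y) \<in> E \<Longrightarrow> y \<in> P1 \<Longrightarrow> x \<in> P1 \<and> (x, y) \<in> R1"
    and leave: "\<And>x y. (x, y) \<in> E \<Longrightarrow> x \<in> P2 \<Longrightarrow> y \<in> P2 \<and> (x, y) \<in> R2"
    and middle: "\<And>x y. (x, y) \<in> E \<Longrightarrow> x \<notin> P1 \<Longrightarrow> y \<notin> P2 \<Longrightarrow> (x, y) \<in> R"
  shows "\<exists>q1 q q2. p = q1 @ q @ q2 \<and> set (vwalk_arcs q1) \<subseteq> R1 \<and>
    set (vwalk_arcs q) \<subseteq> R \<and> set (vwalk_arcs q2) \<subseteq> R2"
proof -
  define q1 where "q1 = takeWhile (\<lambda>x. x \<in> P1) p"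
  define p' where "p' = dropWhile (\<lambda>x. x \<in> P1) p"
  define q where "q = takeWhile (\<lambda>x. x \<notin> P2) p'"
  define q2 where "q2 = dropWhile (\<lambda>x. x \<notin> P2) p'"
  have p: "p = q1 @ p'" "p' = q @ q2" unfolding q1_def p'_def q_def q2_def by auto
  have E: "set (vwalk_arcs q1) \<subseteq> E" "set (vwalk_arcs p') \<subseteq> E"
    "set (vwalk_arcs q) \<subseteq> E" "set (vwalk_arcs q2) \<subseteq> E"
    using assms(1) p vwalk_arcs_sublist[of _ p]
    by (metis order_trans sublist_append_leftI sublist_append_rightI sublist_appendI append.assoc)+
  have "set q1 \<subseteq> P1" unfolding q1_def by (auto dest: set_takeWhileD)
  then have 1: "set (vwalk_arcs q1) \<subseteq> R1"
    using E(1) into vwalk_arcs_subset_Sigma[of q1] by fast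
  have "set p' \<subseteq> - P1"
  proof (cases "p' = []")
    case False
    then have "hd p' \<in> - P1" using hd_dropWhile[of "\<lambda>x. x \<in> P1" p] p'_def by simp
    then show ?thesis using E(2) False into by (intro walk_stays_in_closed_set[of p' E]) auto
  qed simp
  then have "set q \<subseteq> - P1 \<inter> - P2"
    unfolding q_def by (auto dest: set_takeWhileD)
  then have 2: "set (vwalk_arcs q) \<subseteq> R"
    using E(3) middle vwalk_arcs_subset_Sigma[of q] by fast
  have "set q2 \<subseteq> P2"
  proof (cases "q2 = []")
    case False
    then have "hd q2 \<in> P2" using hd_dropWhile[of "\<lambda>x. x \<notin> P2" p'] q2_def by simp
    then show ?thesis using E(4) False leave by (intro walk_stays_in_closed_set[of q2 E]) auto
  qed simp
  then have "set (vwalk_arcs q2) \<subseteq> R2"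
    using E(4) leave vwalk_arcs_subset_Sigma[of q2] by fast
  with 1 2 p show ?thesis by (intro exI[of _ q1] exI[of _ q] exI[of _ q2]) simp
qed

text \<open>
  Dickson's lemma for pairs of numbers. In a counterexample neither function would take a value
  twice, so all but finitely many elements would lie above a given \<open>z\<close> in both coordinates.
\<close>

lemma infinite_pairwise_comparable:
  fixes f g :: "'b \<Rightarrow> nat"
  assumes "infinite S"
  shows "\<exists>x\<in>S. \<exists>y\<in>S. x \<noteq> y \<and> f x \<le> f y \<and> g x \<le> g y"
proof (rule ccontr)
  assume no: "\<not> ?thesis"
  \<comment> \<open>Two elements on which one function agrees are comparable, since the values of the other are
    linearly ordered.\<close>
  have inj: "inj_on f S" "inj_on g S"
    using no by (auto simp: inj_on_def) (metis nat_le_linear order_refl)+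
  obtain z where z: "z \<in> S" using assms by fastforce
  have "finite (f -` {..f z} \<inter> S)" "finite (g -` {..g z} \<inter> S)"
    using inj by (auto intro: finite_vimage_IntI)
  moreover have "S \<subseteq> (f -` {..f z} \<inter> S) \<union> (g -` {..g z} \<inter> S)"
  proof
    fix x assume "x \<in> S"
    then have "f x \<le> f z \<or> g x \<le> g z" using no z by (metis nat_le_linear)
    then show "x \<in> (f -` {..f z} \<inter> S) \<union> (g -` {..g z} \<inter> S)" using \<open>x \<in> S\<close> by auto
  qed
  ultimately show False using assms by (meson finite_UnI finite_subset)
qed

lemma finite_antichain_bicycle:
  fixes H :: "'v pair_pre_digraph"
  assumes "bicycle H" "T \<subseteq> Paths H" "sublist_antichain T"
  shows "finite T"
proof (rule ccontr)
  assume inf: "infinite T"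
  obtain c1 t c2 where
    c1: "c1 = [] \<or> simple_cycle c1 H \<and> set t \<inter> set c1 = {hd t}" and
    c2: "c2 = [] \<or> simple_cycle c2 H \<and> set t \<inter> set c2 = {last t}" and
    t: "vpath t H" and disj: "set c1 \<inter> set c2 = {}" and
    V: "pverts H = set c1 \<union> set t \<union> set c2" and
    E: "parcs H = set (vwalk_arcs c1) \<union> set (vwalk_arcs t) \<union> set (vwalk_arcs c2)"
    using assms(1) unfolding bicycle_def by auto
  have dt: "distinct t" using t by (auto simp: vpath_def)
  let ?R1 = "set (vwalk_arcs c1)" and ?R2 = "set (vwalk_arcs c2)"
  have sv: "single_valued (?R1\<inverse>)"
    using c1 single_valued_simple_cycle(2)[of c1 H] by (cases "c1 = []") auto
  have sv': "single_valued ?R2"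
    using c2 single_valued_simple_cycle(1)[of c2 H] by (cases "c2 = []") auto
  note ends = arcs_in_vwalk_arcs[THEN SigmaD1] arcs_in_vwalk_arcs[THEN SigmaD2]
  have into: "x \<in> set c1 \<and> (x, y) \<in> ?R1" if "(x, y) \<in> parcs H" "y \<in> set c1" for x y
  proof -
    have "(x, y) \<notin> ?R2" using that(2) disj ends(2)[of x y c2] by blast
    moreover have "(x, y) \<notin> set (vwalk_arcs t)"
    proof
      assume arc: "(x, y) \<in> set (vwalk_arcs t)"
      then have "y = hd t" using c1 that(2) ends(2)[of x y t] by auto
      then show False using arc distinct_no_arc_into_hd[OF dt] by simp
    qed
    ultimately have "(x, y) \<in> ?R1" using that(1) E by simp
    then show ?thesis using ends(1)[of x y c1] by simp
  qed
  have leave: "y \<in> set c2 \<and> (x, y) \<in> ?R2" if "(x, y) \<in> parcs H" "x \<in> set c2" for x y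
  proof -
    have "(x, y) \<notin> ?R1" using that(2) disj ends(1)[of x y c1] by blast
    moreover have "(x, y) \<notin> set (vwalk_arcs t)"
    proof
      assume arc: "(x, y) \<in> set (vwalk_arcs t)"
      then have "x = last t" using c2 that(2) ends(1)[of x y t] by auto
      then show False using arc distinct_no_arc_from_last[OF dt] by simp
    qed
    ultimately have "(x, y) \<in> ?R2" using that(1) E by simp
    then show ?thesis using ends(2)[of x y c2] by simp
  qed
  have middle: "(x, y) \<in> set (vwalk_arcs t)"
    if "(x, y) \<in> parcs H" "x \<notin> set c1" "y \<notin> set c2" for x y
    using that E ends(1)[of x y c1] ends(2)[of x y c2] by blast
  have "\<forall>p\<in>T. \<exists>s. p = fst s @ fst (snd s) @ snd (snd s) \<and> set (vwalk_arcs (fst s)) \<subseteq> ?R1 \<and>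
    set (vwalk_arcs (fst (snd s))) \<subseteq> set (vwalk_arcs t) \<and> set (vwalk_arcs (snd (snd s))) \<subseteq> ?R2"
  proof
    fix p assume "p \<in> T"
    then have "set (vwalk_arcs p) \<subseteq> parcs H"
      using assms(2) by (auto simp: Paths_def vwalk_pair_iff)
    from bicycle_path_split[OF this, of "set c1" ?R1 "set c2" ?R2 "set (vwalk_arcs t)"]
    show "\<exists>s. p = fst s @ fst (snd s) @ snd (snd s) \<and> set (vwalk_arcs (fst s)) \<subseteq> ?R1 \<and>
      set (vwalk_arcs (fst (snd s))) \<subseteq> set (vwalk_arcs t) \<and> set (vwalk_arcs (snd (snd s))) \<subseteq> ?R2"
      using into leave middle by auto
  qed
  from bchoice[OF this] obtain s where s: "\<And>p. p \<in> T \<Longrightarrow> p = fst (s p) @ fst (snd (s p)) @ snd (snd (s p)) \<and>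
    set (vwalk_arcs (fst (s p))) \<subseteq> ?R1 \<and> set (vwalk_arcs (fst (snd (s p)))) \<subseteq> set (vwalk_arcs t) \<and>
    set (vwalk_arcs (snd (snd (s p)))) \<subseteq> ?R2"
    by blast
  define q1 q q2 where "q1 p = fst (s p)" and "q p = fst (snd (s p))" and "q2 p = snd (snd (s p))" for p
  have split: "p = q1 p @ q p @ q2 p" "set (vwalk_arcs (q1 p)) \<subseteq> ?R1"
    "set (vwalk_arcs (q p)) \<subseteq> set (vwalk_arcs t)" "set (vwalk_arcs (q2 p)) \<subseteq> ?R2" if "p \<in> T" for p
    using s[OF that] unfolding q1_def q_def q2_def by blast+
  \<comment> \<open>Paths of the same kind differ only in how far they extend outwards along the two cycles.\<close>
  define kind where "kind p = (take 1 (rev (q1 p)), q p, take 1 (q2 p))" for p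
  let ?V = "pverts H"
  let ?L = "{l. set l \<subseteq> ?V \<and> length l \<le> 1}"
  have finV: "finite ?V" unfolding V by simp
  have "kind ` T \<subseteq> ?L \<times> {l. set l \<subseteq> ?V \<and> length l \<le> card ?V} \<times> ?L"
  proof (rule image_subsetI)
    fix p assume p: "p \<in> T"
    have "set p \<subseteq> ?V" using p assms(2) by (auto simp: Paths_def vwalk_pair_iff)
    moreover have "set p = set (q1 p) \<union> set (q p) \<union> set (q2 p)"
      using arg_cong[OF split(1)[OF p], of set] by (simp add: Un_assoc)
    ultimately have sub: "set (q1 p) \<subseteq> ?V" "set (q p) \<subseteq> ?V" "set (q2 p) \<subseteq> ?V" by auto
    have "distinct (q p)" using distinct_if_arcs_of_distinct[OF dt split(3)[OF p]] .
    then have "length (q p) \<le> card ?V"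
      using card_mono[OF finV sub(2)] distinct_card[of "q p"] by simp
    moreover have "set (take 1 (rev (q1 p))) \<subseteq> ?V" "set (take 1 (q2 p)) \<subseteq> ?V"
      using sub set_take_subset[of 1 "rev (q1 p)"] set_take_subset[of 1 "q2 p"] by auto
    ultimately show "kind p \<in> ?L \<times> {l. set l \<subseteq> ?V \<and> length l \<le> card ?V} \<times> ?L"
      using sub(2) by (simp add: kind_def)
  qed
  moreover have "finite (?L \<times> {l. set l \<subseteq> ?V \<and> length l \<le> card ?V} \<times> ?L)"
    using finV by (intro finite_cartesian_product finite_lists_length_le)
  ultimately have "finite (kind ` T)" by (rule finite_subset)
  then obtain p0 where "infinite {p \<in> T. kind p = kind p0}"
    using pigeonhole_infinite[OF inf] by auto
  from infinite_pairwise_comparable[OF this, of "\<lambda>p. length (q1 p)" "\<lambda>p. length (q2 p)"]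
  obtain x y where xy: "x \<in> T" "y \<in> T" "x \<noteq> y" "kind x = kind y"
    "length (q1 x) \<le> length (q1 y)" "length (q2 x) \<le> length (q2 y)"
    by auto
  have "suffix (q1 x) (q1 y)"
    using xy sv split(2) by (intro suffix_if_single_valued[of ?R1]) (auto simp: kind_def)
  moreover have "prefix (q2 x) (q2 y)"
    using xy sv' split(4) by (intro prefix_if_single_valued[of ?R2]) (auto simp: kind_def)
  moreover have "q x = q y" using xy(4) by (simp add: kind_def)
  ultimately obtain u v where "q1 y @ q y @ q2 y = u @ (q1 x @ q x @ q2 x) @ v"
    by (auto simp: suffix_def prefix_def)
  then have "sublist x y" using split(1)[OF xy(1)] split(1)[OF xy(2)] by (metis sublist_appendI)
  then show False using assms(3) xy unfolding sublist_antichain_def by blast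
qed

section \<open>Cycles with an entering and a leaving arc\<close>

text \<open>
  The entering and the leaving arc may coincide: a chord of the cycle plays both parts.
\<close>

definition in_out_cycle :: "'v list \<Rightarrow> 'v pair_pre_digraph \<Rightarrow> bool" where
  "in_out_cycle c G \<longleftrightarrow> simple_cycle c G \<and>
     (\<exists>x v. v \<in> set c \<and> (x, v) \<in> parcs G - set (vwalk_arcs c)) \<and>
     (\<exists>v y. v \<in> set c \<and> (v, y) \<in> parcs G - set (vwalk_arcs c))"

lemma in_out_cycleI:
  assumes "simple_cycle c G"
    and "v \<in> set c" "(x, v) \<in> parcs G" "(x, v) \<notin> set (vwalk_arcs c)"
    and "v' \<in> set c" "(v', y) \<in> parcs G" "(v', y) \<notin> set (vwalk_arcs c)"
  shows "in_out_cycle c G"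
  using assms unfolding in_out_cycle_def by blast

text \<open>
  The walk runs from \<open>v\<close> to the base point \<open>hd c\<close>, around the cycle \<open>n\<close> times, and on to \<open>v'\<close>.
\<close>

lemma long_walk_in_cycle:
  assumes "hd c = last c" "2 \<le> length c" "v \<in> set c" "v' \<in> set c"
  shows "\<exists>q. q \<noteq> [] \<and> hd q = v \<and> last q = v' \<and> n \<le> length q \<and>
    set (vwalk_arcs q) \<subseteq> set (vwalk_arcs c)"
proof -
  have ne: "c \<noteq> []" using assms(2) by auto
  have "\<exists>q. q \<noteq> [] \<and> hd q = hd c \<and> last q = hd c \<and> n \<le> length q \<and>
    set (vwalk_arcs q) \<subseteq> set (vwalk_arcs c)"
  proof (induction n)
    case 0
    show ?case by (intro exI[of _ "[hd c]"]) simp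
  next
    case (Suc n)
    then obtain q where q: "q \<noteq> []" "hd q = hd c" "last q = hd c" "n \<le> length q"
      "set (vwalk_arcs q) \<subseteq> set (vwalk_arcs c)" by blast
    then have j: "joinable q c" using ne by simp
    show ?case
    proof (intro exI conjI)
      show "q \<oplus> c \<noteq> []" using q by simp
      show "hd (q \<oplus> c) = hd c" using vwalk_join_hd[OF j] q by simp
      show "last (q \<oplus> c) = hd c" using vwalk_join_last[OF j] assms(1) by simp
      show "Suc n \<le> length (q \<oplus> c)" using q assms(2) by (simp add: vwalk_join_def)
      show "set (vwalk_arcs (q \<oplus> c)) \<subseteq> set (vwalk_arcs c)" using vwalk_join_arcs[OF j] q by simp
    qed
  qed
  then obtain q where q: "q \<noteq> []" "hd q = hd c" "last q = hd c" "n \<le> length q"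
    "set (vwalk_arcs q) \<subseteq> set (vwalk_arcs c)" by blast
  obtain a b where ab: "c = a @ v # b" using assms(3) by (meson split_list)
  obtain d e where de: "c = d @ v' # e" using assms(4) by (meson split_list)
  have b: "sublist (v # b) c" "last (v # b) = hd c" using ab assms(1) by auto
  have "sublist ((d @ [v']) @ e) c" unfolding de by simp
  then have d: "sublist (d @ [v']) c" "hd (d @ [v']) = hd c"
    using de by (auto simp: hd_append)
  have j: "joinable q (d @ [v'])" using q d by simp
  have j': "joinable (v # b) (q \<oplus> (d @ [v']))" using b q vwalk_join_hd[OF j] by simp
  show ?thesis
  proof (intro exI conjI)
    let ?w = "(v # b) \<oplus> (q \<oplus> (d @ [v']))"
    show "?w \<noteq> []" "hd ?w = v" using vwalk_join_hd[OF j'] by simp_all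
    show "last ?w = v'" using vwalk_join_last[OF j'] vwalk_join_last[OF j] by simp
    show "n \<le> length ?w" using q(1,4) by (simp add: vwalk_join_def)
    show "set (vwalk_arcs ?w) \<subseteq> set (vwalk_arcs c)"
      using q(5) vwalk_arcs_sublist[OF b(1)] vwalk_arcs_sublist[OF d(1)]
      unfolding vwalk_join_arcs[OF j'] vwalk_join_arcs[OF j] by simp
  qed
qed

text \<open>
  The arcs \<open>(x, hd q')\<close> and \<open>(last q', y)\<close> lie outside \<open>R\<close>, so in the longer walk they can only
  be found at its two ends.
\<close>

lemma not_sublist_marked_walks:
  assumes "set (vwalk_arcs q) \<subseteq> R" "q' \<noteq> []" "(x, hd q') \<notin> R" "(last q', y) \<notin> R"
    and "sublist (x # q' @ [y]) (x # q @ [y])"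
  shows "q' = q"
proof -
  obtain a b where ab: "x # q @ [y] = a @ (x # q' @ [y]) @ b"
    using assms(5) unfolding sublist_def by blast
  have not_start: "\<not> sublist (x # q') q"
    using vwalk_arcs_sublist[of "x # q'" q] assms(1-3) by auto
  have not_end: "\<not> sublist (q' @ [y]) q"
    using vwalk_arcs_sublist[of "q' @ [y]" q] assms(1,2,4) by (auto simp: vwalk_arcs_append)
  have "a = []"
  proof (rule ccontr)
    assume "a \<noteq> []"
    then obtain a' where "a = x # a'" using ab by (cases a) auto
    then have "q @ [y] = (a' @ (x # q')) @ ([y] @ b)" using ab by simp
    then have "q = (a' @ (x # q')) @ butlast ([y] @ b)"
      by (metis append_is_Nil_conv butlast_append butlast_snoc not_Cons_self2)
    then show False using not_start by (metis append.assoc sublist_appendI)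
  qed
  moreover have "b = []"
  proof (rule ccontr)
    assume "b \<noteq> []"
    moreover have "q @ [y] = (q' @ [y]) @ b" using ab \<open>a = []\<close> by simp
    ultimately have "q = (q' @ [y]) @ butlast b" by (metis butlast_append butlast_snoc)
    then show False using not_end by (metis sublist_append_rightI)
  qed
  ultimately show ?thesis using ab by simp
qed

lemma infinite_antichain_in_out_cycle:
  assumes "pair_wf_digraph G" "in_out_cycle c G"
  shows "\<exists>T \<subseteq> Paths G. infinite T \<and> sublist_antichain T"
proof -
  interpret pair_wf_digraph G by (rule assms(1))
  let ?R = "set (vwalk_arcs c)"
  have c: "simple_cycle c G" using assms(2) unfolding in_out_cycle_def by blast
  then have cyc: "hd c = last c" "2 \<le> length c" and cG: "set c \<subseteq> pverts G" "?R \<subseteq> parcs G"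
    unfolding simple_cycle_def vwalk_pair_iff by auto
  obtain x v v' y where v: "v \<in> set c" "(x, v) \<in> parcs G" "(x, v) \<notin> ?R"
    and v': "v' \<in> set c" "(v', y) \<in> parcs G" "(v', y) \<notin> ?R"
    using assms(2) unfolding in_out_cycle_def by blast
  define T where "T = (\<lambda>q. x # q @ [y]) ` {q. q \<noteq> [] \<and> hd q = v \<and> last q = v' \<and> set (vwalk_arcs q) \<subseteq> ?R}"
  have "T \<subseteq> Paths G"
  proof
    fix p assume "p \<in> T"
    then obtain q where p: "p = x # q @ [y]" and q: "q \<noteq> []" "hd q = v" "last q = v'"
      "set (vwalk_arcs q) \<subseteq> ?R" unfolding T_def by blast
    have "set q \<subseteq> set c"
      using walk_stays_in_closed_set[of q ?R "set c"] q v arcs_in_vwalk_arcs by fastforce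
    moreover have "set (vwalk_arcs (q @ [y])) \<subseteq> parcs G"
      using q cG v' by (subst vwalk_arcs_append_iff) auto
    ultimately show "p \<in> Paths G"
      using p q v v' cG in_arcsD1[of x v] in_arcsD2[of v' y]
      unfolding Paths_def vwalk_pair_iff by auto
  qed
  moreover have "sublist_antichain T"
    unfolding sublist_antichain_def T_def
    using not_sublist_marked_walks[of _ ?R _ x y] v(3) v'(3) by auto
  moreover have "infinite T"
  proof
    assume "finite T"
    then obtain n where n: "\<And>p. p \<in> T \<Longrightarrow> length p < n" using finite_maxlen by blast
    obtain q where "q \<noteq> []" "hd q = v" "last q = v'" "n \<le> length q" "set (vwalk_arcs q) \<subseteq> ?R"
      using long_walk_in_cycle[OF cyc v(1) v'(1), of n] by blast
    then show False using n[of "x # q @ [y]"] unfolding T_def by auto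
  qed
  ultimately show ?thesis by blast
qed

section \<open>Bicycles from paths\<close>

lemma bicycle_subgraphI:
  assumes "pair_wf_digraph G"
    and "c1 = [] \<or> simple_cycle c1 G \<and> set t \<inter> set c1 = {hd t}"
    and "c2 = [] \<or> simple_cycle c2 G \<and> set t \<inter> set c2 = {last t}"
    and "vpath t G" "set c1 \<inter> set c2 = {}"
    and "p \<noteq> []" "set p \<subseteq> set c1 \<union> set t \<union> set c2"
    and "set (vwalk_arcs p) \<subseteq> set (vwalk_arcs c1) \<union> set (vwalk_arcs t) \<union> set (vwalk_arcs c2)"
  shows "\<exists>H. subgraph (with_proj H) (with_proj G) \<and> bicycle H \<and> p \<in> Paths H"
proof -
  define H where "H = \<lparr>pverts = set c1 \<union> set t \<union> set c2,
    parcs = set (vwalk_arcs c1) \<union> set (vwalk_arcs t) \<union> set (vwalk_arcs c2)\<rparr>"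
  have sel: "pverts H = set c1 \<union> set t \<union> set c2"
    "parcs H = set (vwalk_arcs c1) \<union> set (vwalk_arcs t) \<union> set (vwalk_arcs c2)"
    unfolding H_def by simp_all
  have "pair_wf_digraph H"
    by unfold_locales (auto simp: sel dest!: arcs_in_vwalk_arcs)
  moreover have "pverts H \<subseteq> pverts G" "parcs H \<subseteq> parcs G"
    using assms(2-4) unfolding sel simple_cycle_def vpath_def vwalk_pair_iff by auto
  ultimately have "subgraph (with_proj H) (with_proj G)"
    using assms(1) unfolding subgraph_def compatible_def wf_digraph_wp_iff by simp
  moreover have "bicycle H"
    unfolding bicycle_def
  proof (intro exI conjI)
    show "c1 = [] \<or> simple_cycle c1 H \<and> set t \<inter> set c1 = {hd t}"
      using assms(2) unfolding simple_cycle_def vwalk_pair_iff sel by blast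
    show "c2 = [] \<or> simple_cycle c2 H \<and> set t \<inter> set c2 = {last t}"
      using assms(3) unfolding simple_cycle_def vwalk_pair_iff sel by blast
    show "vpath t (with_proj H)"
      using assms(4) unfolding vpath_def vwalk_pair_iff sel by blast
  qed (rule assms(5) sel)+
  moreover have "p \<in> Paths H" using assms(6-8) unfolding Paths_def vwalk_pair_iff sel by simp
  ultimately show ?thesis by blast
qed

lemma simple_cycle_if_walk:
  assumes "set (v # g @ [v]) \<subseteq> pverts G" "set (vwalk_arcs (v # g @ [v])) \<subseteq> parcs G"
    and "distinct (v # g)"
  shows "simple_cycle (v # g @ [v]) G"
  using assms unfolding simple_cycle_def vwalk_pair_iff by simp

text \<open>
  Follow \<open>p\<close> to its first repetition, where a simple cycle closes. Either the cycle starts with the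
  first vertex of \<open>p\<close>, or \<open>p\<close> has come in from outside; in this case no arc leaves the cycle, so
  the rest of \<open>p\<close> runs along it, and \<open>p\<close> is a simple path \<open>t\<close> leading into a cycle \<open>c\<close>. The
  empty \<open>c\<close> covers simple paths.
\<close>

lemma path_shape:
  assumes no: "\<And>c. \<not> in_out_cycle c G" and walk: "vwalk p (with_proj G)"
  shows "(\<exists>v g b. p = v # g @ v # b \<and> simple_cycle (v # g @ [v]) G) \<or>
    (\<exists>t c. vpath t (with_proj G) \<and> hd t = hd p \<and>
      (c = [] \<or> simple_cycle c G \<and> set t \<inter> set c = {last t} \<and> hd p \<notin> set c) \<and>
      set p = set t \<union> set c \<and> set (vwalk_arcs p) \<subseteq> set (vwalk_arcs t) \<union> set (vwalk_arcs c))"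
proof (cases "distinct p")
  case True
  then have "vpath p (with_proj G)" using walk by (simp add: vpath_def)
  then show ?thesis by (intro disjI2 exI[of _ p] exI[of _ "[]"]) simp
next
  case False
  then obtain xs v b where p: "p = xs @ v # b" "v \<in> set xs" "distinct xs"
    unfolding not_distinct_conv_prefix by blast
  then obtain a g where xs: "xs = a @ v # g" by (meson split_list)
  let ?c = "v # g @ [v]"
  have pG: "set p \<subseteq> pverts G" "set (vwalk_arcs p) \<subseteq> parcs G"
    using walk by (auto simp: vwalk_pair_iff)
  have sub: "sublist ?c p" "sublist (v # b) p" "sublist (a @ [v]) p"
    using p(1) xs sublist_appendI[of ?c a b] sublist_append_leftI[of "v # b" "a @ v # g"]
      sublist_append_rightI[of "a @ [v]" "g @ v # b"] by auto
  have c: "simple_cycle ?c G"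
    using simple_cycle_if_walk[of v g G] set_mono_sublist[OF sub(1)] vwalk_arcs_sublist[OF sub(1)]
      pG p(3) xs by auto
  show ?thesis
  proof (cases "a = []")
    case True
    then show ?thesis using p xs c by auto
  next
    case False
    \<comment> \<open>The cycle is entered from \<open>last a\<close>.\<close>
    have last_a: "last a \<notin> set ?c" "hd a \<notin> set ?c"
    proof -
      have "x \<notin> set ?c" if "x \<in> set a" for x using that p(3) xs by auto
      then show "last a \<notin> set ?c" "hd a \<notin> set ?c" using False by simp_all
    qed
    have "(last a, v) \<in> set (vwalk_arcs p)"
      using p(1) xs False by (auto simp: vwalk_arcs_append)
    then have "(last a, v) \<in> parcs G" using pG(2) by blast
    moreover have "(last a, v) \<notin> set (vwalk_arcs ?c)"
      using last_a arcs_in_vwalk_arcs[of "(last a, v)" ?c] by auto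
    ultimately have inner: "(u, w) \<in> set (vwalk_arcs ?c)" if "(u, w) \<in> parcs G" "u \<in> set ?c" for u w
      using no[of ?c] in_out_cycleI[OF c, of v "last a" u w] that by auto
    have bG: "set (vwalk_arcs (v # b)) \<subseteq> parcs G" using vwalk_arcs_sublist[OF sub(2)] pG by blast
    have bc: "set (v # b) \<subseteq> set ?c"
    proof (rule walk_stays_in_closed_set[OF bG])
      show "w \<in> set ?c" if "(u, w) \<in> parcs G" "u \<in> set ?c" for u w
        using arcs_in_vwalk_arcs[OF inner[OF that]] by auto
    qed auto
    have b_arcs: "set (vwalk_arcs (v # b)) \<subseteq> set (vwalk_arcs ?c)"
    proof (rule subrelI)
      fix u w assume "(u, w) \<in> set (vwalk_arcs (v # b))"
      then show "(u, w) \<in> set (vwalk_arcs ?c)"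
        using bG bc by (blast intro: inner dest: arcs_in_vwalk_arcs)
    qed
    have "vpath (a @ [v]) (with_proj G)"
      using p(3) xs set_mono_sublist[OF sub(3)] vwalk_arcs_sublist[OF sub(3)] pG
      unfolding vpath_def vwalk_pair_iff by auto
    moreover have "set (a @ [v]) \<inter> set ?c = {last (a @ [v])}" using p(3) xs by auto
    moreover have "hd (a @ [v]) = hd p" "hd p \<notin> set ?c" using p(1) xs False last_a by auto
    moreover have "set p = set (a @ [v]) \<union> set ?c" using p(1) xs bc by auto
    moreover have "set (vwalk_arcs p) \<subseteq> set (vwalk_arcs (a @ [v])) \<union> set (vwalk_arcs ?c)"
    proof -
      have "p = (a @ [v]) \<oplus> (?c \<oplus> (v # b))" using p(1) xs by (simp add: vwalk_join_def)
      moreover have "joinable ?c (v # b)" "joinable (a @ [v]) (?c \<oplus> (v # b))"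
        by (simp_all add: vwalk_join_def)
      ultimately have "vwalk_arcs p = vwalk_arcs (a @ [v]) @ vwalk_arcs ?c @ vwalk_arcs (v # b)"
        by (metis vwalk_join_arcs)
      then have "set (vwalk_arcs p) =
          set (vwalk_arcs (a @ [v])) \<union> (set (vwalk_arcs ?c) \<union> set (vwalk_arcs (v # b)))"
        by (simp only: set_append)
      then show ?thesis using b_arcs by blast
    qed
    ultimately show ?thesis using c by blast
  qed
qed

lemma split_at_first_arc_outside:
  assumes "p \<noteq> []" "\<not> set (vwalk_arcs p) \<subseteq> R"
  shows "\<exists>d e. p = d @ e \<and> d \<noteq> [] \<and> e \<noteq> [] \<and> set (vwalk_arcs d) \<subseteq> R \<and> (last d, hd e) \<notin> R"
  using assms
proof (induction p)
  case (Cons x p)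
  then have ne: "p \<noteq> []" by auto
  show ?case
  proof (cases "(x, hd p) \<in> R")
    case True
    then have "\<not> set (vwalk_arcs p) \<subseteq> R" using Cons.prems ne by auto
    then obtain d e where "p = d @ e" "d \<noteq> []" "e \<noteq> []" "set (vwalk_arcs d) \<subseteq> R" "(last d, hd e) \<notin> R"
      using Cons.IH[OF ne] by blast
    then show ?thesis using True by (intro exI[of _ "x # d"] exI[of _ e]) auto
  next
    case False
    then show ?thesis using ne by (intro exI[of _ "[x]"] exI[of _ p]) auto
  qed
qed simp

text \<open>
  If \<open>p\<close> leaves the cycle on which it starts, that cycle becomes the initial one. It has a leaving
  arc, hence no entering arc, so the remainder of \<open>p\<close> avoids it. By \<open>path_shape\<close> this remainder
  supplies the connecting path and the terminal cycle.
\<close>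

lemma path_in_bicycle:
  assumes wf: "pair_wf_digraph G" and no: "\<And>c. \<not> in_out_cycle c G" and p: "p \<in> Paths G"
  shows "\<exists>H. subgraph (with_proj H) (with_proj G) \<and> bicycle H \<and> p \<in> Paths H"
proof -
  have walk: "vwalk p (with_proj G)" using p by (simp add: Paths_def)
  then have pG: "p \<noteq> []" "set p \<subseteq> pverts G" "set (vwalk_arcs p) \<subseteq> parcs G"
    by (auto simp: vwalk_pair_iff)
  consider (lasso) t c where "vpath t (with_proj G)"
      "c = [] \<or> simple_cycle c G \<and> set t \<inter> set c = {last t}"
      "set p = set t \<union> set c" "set (vwalk_arcs p) \<subseteq> set (vwalk_arcs t) \<union> set (vwalk_arcs c)"
    | (returns) v g b where "p = v # g @ v # b" "simple_cycle (v # g @ [v]) G"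
    using path_shape[OF no walk] by blast
  then show ?thesis
  proof cases
    case lasso
    then show ?thesis using bicycle_subgraphI[OF wf, of "[]" t c p] pG(1) by simp
  next
    case returns
    note p = returns(1) and c = returns(2)
    let ?c = "v # g @ [v]" and ?R = "set (vwalk_arcs (v # g @ [v]))"
    have "p = ?c \<oplus> (v # b)" using p by (simp add: vwalk_join_def)
    then have p_arcs: "set (vwalk_arcs p) = ?R \<union> set (vwalk_arcs (v # b))"
      using vwalk_join_arcs[of ?c "v # b"] by simp
    have R_closed: "w \<in> set ?c" if "(u, w) \<in> ?R" for u w
      using arcs_in_vwalk_arcs[OF that] by auto
    show ?thesis
    proof (cases "set (vwalk_arcs (v # b)) \<subseteq> ?R")
      case True
      then have "set (v # b) \<subseteq> set ?c"
        by (rule walk_stays_in_closed_set) (use R_closed in auto)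
      then show ?thesis
        using pG p c True p_arcs
        by (intro bicycle_subgraphI[OF wf, of ?c "[v]" "[]"]) (auto simp: vpath_def vwalk_pair_iff)
    next
      case False
      then obtain d e where de: "v # b = d @ e" "d \<noteq> []" "e \<noteq> []" "set (vwalk_arcs d) \<subseteq> ?R"
        and out: "(last d, hd e) \<notin> ?R"
        using split_at_first_arc_outside[of "v # b" ?R] by blast
      \<comment> \<open>The walk leaves the initial cycle from \<open>z\<close>, which becomes the start of the connecting path.\<close>
      define z where "z = last d"
      have "hd d = v" using de by (metis hd_append2 list.sel(1))
      then have dc: "set d \<subseteq> set ?c"
        using walk_stays_in_closed_set[OF de(4,2), of "set ?c"] R_closed by auto
      then have z: "z \<in> set ?c" using last_in_set[OF de(2)] unfolding z_def by blast
      have b_arcs: "set (vwalk_arcs (v # b)) =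
        set (vwalk_arcs d) \<union> insert (z, hd e) (set (vwalk_arcs e))"
        using de unfolding z_def by (simp add: vwalk_arcs_append)
      then have arcsG: "(z, hd e) \<in> parcs G" "set (vwalk_arcs e) \<subseteq> parcs G"
        using p_arcs pG by auto
      have no_in: "(u, w) \<in> ?R" if "(u, w) \<in> parcs G" "w \<in> set ?c" for u w
        using no[of ?c] in_out_cycleI[OF c that(2,1) _ z arcsG(1)] out unfolding z_def by blast
      have "hd e \<notin> set ?c" using no_in[OF arcsG(1)] out unfolding z_def by blast
      then have e: "set e \<subseteq> - set ?c"
      proof (intro walk_stays_in_closed_set[OF arcsG(2) de(3)])
        show "w \<in> - set ?c" if "(u, w) \<in> parcs G" "u \<in> - set ?c" for u w
          using that no_in[of u w] arcs_in_vwalk_arcs[of "(u, w)" ?c] by auto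
      qed simp
      have ze: "vwalk (z # e) (with_proj G)"
        using arcsG de(3) pG(2) p z de(1) unfolding vwalk_pair_iff by auto
      have "\<not> (\<exists>v g b. z # e = v # g @ v # b \<and> simple_cycle (v # g @ [v]) G)"
        using e z by auto
      then obtain t c2 where t: "vpath t (with_proj G)" "hd t = z"
        and c2: "c2 = [] \<or> simple_cycle c2 G \<and> set t \<inter> set c2 = {last t} \<and> z \<notin> set c2"
        and cover: "set (z # e) = set t \<union> set c2"
          "set (vwalk_arcs (z # e)) \<subseteq> set (vwalk_arcs t) \<union> set (vwalk_arcs c2)"
        using path_shape[OF no ze] by auto
      have "z \<in> set t" using t unfolding vpath_def vwalk_pair_iff by auto
      then have t_c: "set t \<inter> set ?c = {hd t}" using t(2) cover(1) e z by auto
      have "set c2 \<inter> set ?c = {}" using c2 cover(1) e by auto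
      moreover have "set (vwalk_arcs (z # e)) = insert (z, hd e) (set (vwalk_arcs e))"
        using de(3) by simp
      then have "set (vwalk_arcs p) \<subseteq> ?R \<union> set (vwalk_arcs t) \<union> set (vwalk_arcs c2)"
        using p_arcs b_arcs de(4) cover(2) by blast
      moreover have "set p \<subseteq> set ?c \<union> set t \<union> set c2"
      proof -
        have "set (v # b) = set d \<union> set e" by (simp only: de(1) set_append)
        moreover have "set p = set ?c \<union> set (v # b)" using p by auto
        ultimately show ?thesis using dc cover(1) by auto
      qed
      ultimately show ?thesis
        using bicycle_subgraphI[OF wf, of ?c t c2 p] c c2 t t_c pG(1) by blast
    qed
  qed
qed

text \<open>
  In the absence of in-out cycles all bicycle subgraphs together form the decomposition.
\<close>

theorem wqo_Paths_iff_bicycle_decomposition: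
  assumes "pair_fin_digraph G"
  shows "wqo_on sublist (Paths G) \<longleftrightarrow>
    (\<exists>\<H>. path_complete_decomposition G \<H> \<and> (\<forall>H \<in> \<H>. bicycle H))"
proof
  interpret pair_fin_digraph G by (rule assms)
  have wf: "pair_wf_digraph G" by unfold_locales
  assume "wqo_on sublist (Paths G)"
  then have no: "\<not> in_out_cycle c G" for c
    using infinite_antichain_in_out_cycle[OF wf] unfolding wqo_on_sublist_iff by blast
  let ?H = "{H. subgraph (with_proj H) (with_proj G) \<and> bicycle H}"
  have "?H \<subseteq> (\<lambda>(V, E). \<lparr>pverts = V, parcs = E\<rparr>) ` (Pow (pverts G) \<times> Pow (parcs G))"
  proof
    fix H assume "H \<in> ?H"
    then have sub: "(pverts H, parcs H) \<in> Pow (pverts G) \<times> Pow (parcs G)"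
      by (auto simp: subgraph_def)
    show "H \<in> (\<lambda>(V, E). \<lparr>pverts = V, parcs = E\<rparr>) ` (Pow (pverts G) \<times> Pow (parcs G))"
      by (rule image_eqI[OF _ sub]) simp
  qed
  then have "finite ?H"
    by (rule finite_subset) (simp add: pair_finite_verts pair_finite_arcs)
  moreover have "Paths H \<subseteq> Paths G" if "H \<in> ?H" for H
    using that unfolding Paths_def vwalk_pair_iff subgraph_def by auto
  moreover have "Paths G \<subseteq> (\<Union>H\<in>?H. Paths H)"
    using path_in_bicycle[OF wf no] by blast
  ultimately have "path_complete_decomposition G ?H"
    unfolding path_complete_decomposition_def by blast
  then show "\<exists>\<H>. path_complete_decomposition G \<H> \<and> (\<forall>H \<in> \<H>. bicycle H)" by blast
next
  assume "\<exists>\<H>. path_complete_decomposition G \<H> \<and> (\<forall>H \<in> \<H>. bicycle H)"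
  then obtain \<H> where "path_complete_decomposition G \<H>"
    and bi: "\<And>H. H \<in> \<H> \<Longrightarrow> bicycle H" by blast
  then have fin: "finite \<H>" and cover: "Paths G = (\<Union>H \<in> \<H>. Paths H)"
    unfolding path_complete_decomposition_def by simp_all
  show "wqo_on sublist (Paths G)"
    unfolding wqo_on_sublist_iff
  proof (intro allI impI)
    fix T assume T: "T \<subseteq> Paths G" "sublist_antichain T"
    have "finite (T \<inter> Paths H)" if "H \<in> \<H>" for H
      using finite_antichain_bicycle[OF bi[OF that] Int_lower2]
        sublist_antichain_subset[OF T(2) Int_lower1] by blast
    then have "finite (\<Union>H \<in> \<H>. T \<inter> Paths H)" using fin by blast
    moreover have "T = (\<Union>H \<in> \<H>. T \<inter> Paths H)" using T(1) unfolding cover by blast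
    ultimately show "finite T" by simp
  qed
qed

section \<open>Finitely based classes of words\<close>

lemma pair_fin_digraph_factor_graph:
  assumes "finite A" "C \<subseteq> lists A"
  shows "pair_fin_digraph (factor_graph A C)"
proof -
  let ?G = "factor_graph A C"
  have "pverts ?G \<subseteq> {w. set w \<subseteq> A \<and> length w = basis_bound A C}"
    using assms(2) unfolding pverts_factor_graph by auto
  then have fin: "finite (pverts ?G)"
    using finite_lists_length_eq[OF assms(1)] by (rule finite_subset)
  have arcs: "parcs ?G \<subseteq> pverts ?G \<times> pverts ?G" by (auto simp: parcs_factor_graph_iff)
  then have "finite (parcs ?G)" using fin by (meson finite_SigmaI finite_subset)
  with fin arcs show ?thesis by unfold_locales auto
qed

theorem theorem5p2:
  fixes A :: "'a set" and C :: "'a list set"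
  assumes "finite A"
    and "C \<subseteq> lists A"
    and "downward_closed C"
    and "finitely_based A C"
    and "basis A C \<noteq> {}"
    and "1 \<le> basis_bound A C"
  shows "wqo_on sublist C \<longleftrightarrow>
    (\<exists>\<H>. path_complete_decomposition (factor_graph A C) \<H> \<and> (\<forall>H \<in> \<H>. bicycle H))"
  using wqo_iff_wqo_Paths[OF assms(1-4,6)]
    wqo_Paths_iff_bicycle_decomposition[OF pair_fin_digraph_factor_graph[OF assms(1,2)]]
  by blast

end
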